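(* Let $p>0$, let $X_p$ be the $p$-singular Cantor-type random variable with CDF $F_p$, and let $m_p$ and $e_p$ be its mean residual life and generalized mean residual life functions. Then: (i) $\mathbb E[X_p]=\dfrac32\cdot\dfrac{p}{2p+1}$. (ii) $m_p$ is continuous on $[0,1]$, $e_p$ is continuous on $(0,1)$, and for every $x\in(0,1)$, each of $m_p$ and $e_p$ is locally decreasing at $x$ if and only if $x\in[0,1]\setminus\mathcal C$. (iii) The equation $m_p(x)=x$ has a unique solution $x_p^*$ in $[0,1]$, given by $$x_p^*=\frac16+\frac{5p+4}{12(2p+1)}.$$ Moreover, $p\mapsto x_p^*$ is decreasing on $(0,\infty)$ and $x_p^*\in(3/8,1/2)$ for every $p>0$.
   Context: For $p>0$, the $p$-singular Cantor-type distribution has CDF $F_p:[0,1]\to\mathbb R$, defined as the unique real-valued, monotone nondecreasing function satisfying (a) $F_p(x/3)=F_p(x)/(p+1)$ for all $x\in[0,1]$, and (b) $F_p(1-x)=1-pF_p(x)$ for all $x\in[0,1/3]$. It is continuous, with $F_p(0)=0$, $F_p(1)=1$, and $F_p(x)=1/(p+1)$ for all $x\in[1/3,2/3]$. For $p=1$ it is the Cantor distribution. The Cantor set is $\mathcal C=\bigcap_{n\ge1}C_n$, where $C_0=[0,1]$ and $C_n=\tfrac13C_{n-1}\cup(\tfrac23+\tfrac13C_{n-1})$. The MRL function of $X_p$ is $m_p(x)=\frac{1}{1-F_p(x)}\int_x^1(1-F_p(u))\,du$ for $x<1$ and $m_p(x)=0$ for $x\ge1$. The generalized MRL function is $e_p(x)=m_p(x)/x$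 for $0<x<1$. A function $f:(0,1)\to\mathbb R$ is locally decreasing at $x$ if there is an open neighborhood $U$ of $x$ such that $f|_U$ is non-increasing. *)

theory Defs
  imports "HOL-Analysis.Analysis"
begin

text \<open>The p-singular Cantor-type CDF: the unique function that is monotone
non-decreasing on [0,1] and satisfies (a) and (b) there; it is extended to the
whole real line by 0 to the left of 0 and by 1 to the right of 1 (the standard
extension of a CDF of a [0,1]-valued random variable).\<close>
definition cantor_cdf :: "real \<Rightarrow> real \<Rightarrow> real" where
  "cantor_cdf p = (THE F.
      mono_on {0..1} F \<and>
      (\<forall>x\<in>{0..1}. F (x / 3) = F x / (p + 1)) \<and>
      (\<forall>x\<in>{0..1/3}. F (1 - x) = 1 - p * F x) \<and>
      (\<forall>x<0. F x = 0) \<and> (\<forall>x>1. F x = 1))"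

definition cantor_law :: "real \<Rightarrow> real measure" where
  "cantor_law p = interval_measure (cantor_cdf p)"

definition mrl :: "real \<Rightarrow> real \<Rightarrow> real" where
  "mrl p x = (if x < 1
      then integral {x..1} (\<lambda>u. 1 - cantor_cdf p u) / (1 - cantor_cdf p x)
      else 0)"

text \<open>Generalized mean residual life function (meaningful for 0 < x < 1).\<close>
definition gmrl :: "real \<Rightarrow> real \<Rightarrow> real" where
  "gmrl p x = mrl p x / x"

fun cantor_stage :: "nat \<Rightarrow> real set" where
  "cantor_stage 0 = {0..1}"
| "cantor_stage (Suc n) =
     (\<lambda>x. x / 3) ` cantor_stage n \<union> (\<lambda>x. 2/3 + x / 3) ` cantor_stage n"

definition cantor_set :: "real set" where
  "cantor_set = (\<Inter>n. cantor_stage n)"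

definition locally_decreasing_at :: "(real \<Rightarrow> real) \<Rightarrow> real \<Rightarrow> bool" where
  "locally_decreasing_at f x \<longleftrightarrow>
     (\<exists>U. open U \<and> x \<in> U \<and> U \<subseteq> {0<..<1} \<and> antimono_on U f)"

end

theory Submission
  imports Defs "HOL-Probability.Distribution_Functions"
begin

text \<open>On the whole real line, conditions (a) and (b) say that \<open>F = cantor_cdf p\<close> is a fixed point of
  a contraction, which gives existence, uniqueness and continuity. A primitive of \<open>F\<close> inherits
  the self-similarity; this determines \<open>\<integral>F\<close> on \<open>[0,1]\<close>, hence the mean and the value of the
  mean residual life on the middle third, where it meets the diagonal. To the left of \<open>1/3\<close> it
  stays strictly above the diagonal because this property passes from \<open>y\<close> to \<open>y/3\<close>.

  Off the Cantor set \<open>F\<close> is locally constant, so both functions decrease there. Conversely, if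
  the generalized function decreases near \<open>x\<close>, then \<open>F\<close> is Lipschitz near \<open>x\<close>; if \<open>x\<close> were in the
  Cantor set, zooming in would make \<open>F\<close> Lipschitz on \<open>[0,1]\<close>, which is impossible since the
  heavier third has mass at least \<open>1/2\<close> but length only \<open>1/3\<close>.\<close>

text \<open>For distribution functions of laws on \<open>[0,1]\<close> the cut may be put anywhere in
  \<open>[1/3,2/3]\<close>, and no separate clause for the middle third is needed.\<close>
definition cantor_step :: "real \<Rightarrow> (real \<Rightarrow> real) \<Rightarrow> real \<Rightarrow> real" where
  "cantor_step p f x = (if x \<le> 1/2 then f (3 * x) / (p + 1) else 1 - p / (p + 1) * f (3 - 3 * x))"

text \<open>Continuity is left out because the axioms in \<open>cantor_cdf\<close> do not state it;
  it comes from the construction of the fixed point.\<close>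

definition unit_cdfs :: "(real \<Rightarrow> real) set" where
  "unit_cdfs = {f. mono f \<and> (\<forall>x\<le>0. f x = 0) \<and> (\<forall>x\<ge>1. f x = 1)}"

lemma unit_cdfs_bounds:
  assumes "f \<in> unit_cdfs"
  shows "0 \<le> f x" "f x \<le> 1"
proof -
  have "f (min x 0) \<le> f x" "f x \<le> f (max x 1)"
    using assms unfolding unit_cdfs_def by (blast intro: monoD min.cobounded1 max.cobounded1)+
  then show "0 \<le> f x" "f x \<le> 1"
    using assms by (auto simp: unit_cdfs_def)
qed

lemma cantor_stage_SucI:
  assumes "x \<in> cantor_stage n"
  shows "x / 3 \<in> cantor_stage (Suc n)" "2/3 + x / 3 \<in> cantor_stage (Suc n)"
  using assms by auto

text \<open>The stages use a translated copy on the right, \<open>cantor_step\<close> a reflected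
  one; this symmetry reconciles the two.\<close>

lemma cantor_stage_reflect: "x \<in> cantor_stage n \<Longrightarrow> 1 - x \<in> cantor_stage n"
proof (induction n arbitrary: x)
  case 0
  then show ?case by simp
next
  case (Suc n)
  then consider y where "y \<in> cantor_stage n" "x = y / 3" | y where "y \<in> cantor_stage n" "x = 2/3 + y / 3"
    by auto
  then show ?case
  proof cases
    case 1
    then have x: "1 - x = 2/3 + (1 - y) / 3" by (simp add: field_simps)
    show ?thesis unfolding x by (rule cantor_stage_SucI(2)[OF Suc.IH[OF 1(1)]])
  next
    case 2
    then have x: "1 - x = (1 - y) / 3" by (simp add: field_simps)
    show ?thesis unfolding x by (rule cantor_stage_SucI(1)[OF Suc.IH[OF 2(1)]])
  qed
qed

section \<open>Existence, uniqueness and continuity of the distribution function by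
  contraction\<close>

context
  fixes p :: real
  assumes p_pos: "p > 0"
begin

lemma cantor_step_unit_cdfs:
  assumes f: "f \<in> unit_cdfs"
  shows "cantor_step p f \<in> unit_cdfs"
proof -
  note b = unit_cdfs_bounds[OF f]
  have m: "f x \<le> f y" if "x \<le> y" for x y
    using f that by (auto simp: unit_cdfs_def monoD)
  have "mono (cantor_step p f)"
  proof (rule monoI)
    fix x y :: real assume xy: "x \<le> y"
    consider "y \<le> 1/2" | "x > 1/2" | "x \<le> 1/2" "y > 1/2" using xy by linarith
    then show "cantor_step p f x \<le> cantor_step p f y"
    proof cases
      case 1
      then show ?thesis using m[of "3*x" "3*y"] xy p_pos
        by (simp add: cantor_step_def divide_right_mono)
    next
      case 2
      then show ?thesis using m[of "3-3*y" "3-3*x"] xy p_pos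
        by (simp add: cantor_step_def divide_right_mono mult_left_mono)
    next
      case 3
      \<comment> \<open>The value \<open>1 / (p + 1)\<close> separates the branches: the left one
        stays below it, the right one above.\<close>
      have "f (3*x) / (p+1) \<le> 1 / (p+1)" using b p_pos by (simp add: divide_right_mono)
      also have "\<dots> = 1 - p / (p+1) * 1" using p_pos by (simp add: field_simps)
      also have "\<dots> \<le> 1 - p / (p+1) * f (3-3*y)"
        using mult_left_mono[OF b(2)[of "3-3*y"], of "p/(p+1)"] p_pos by simp
      finally show ?thesis using 3 by (simp add: cantor_step_def)
    qed
  qed
  then show ?thesis
    using f by (auto simp: unit_cdfs_def cantor_step_def)
qed

lemma cantor_step_iterate_unit_cdfs:
  "f \<in> unit_cdfs \<Longrightarrow> (cantor_step p ^^ n) f \<in> unit_cdfs"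
  by (induction n) (auto intro: cantor_step_unit_cdfs)

lemma cantor_step_continuous:
  assumes f: "f \<in> unit_cdfs" and c: "continuous_on UNIV f"
  shows "continuous_on UNIV (cantor_step p f)"
proof -
  have U: "UNIV = {..1/2::real} \<union> {1/2..}" by auto
  have c': "continuous_on A (\<lambda>x. f (g x))" if "continuous_on A g" for A and g :: "real \<Rightarrow> real"
    using continuous_on_compose2[OF c that] by auto
  have "continuous_on ({..1/2::real} \<union> {1/2..})
      (\<lambda>x. if x \<le> 1/2 then f (3 * x) / (p + 1) else 1 - p / (p + 1) * f (3 - 3 * x))"
  proof (rule continuous_on_cases)
    show "\<forall>x. x \<in> {..1/2} \<and> \<not> x \<le> 1/2 \<or> x \<in> {1/2..} \<and> x \<le> 1/2 \<longrightarrow>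
        f (3 * x) / (p + 1) = 1 - p / (p + 1) * f (3 - 3 * x)"
    proof (intro allI impI)
      fix x :: real assume "x \<in> {..1/2} \<and> \<not> x \<le> 1/2 \<or> x \<in> {1/2..} \<and> x \<le> 1/2"
      then have x: "x = 1/2" by auto
      \<comment> \<open>At the cut both arguments are \<open>3/2\<close>, where \<open>f\<close> is
        already 1, so both branches give \<open>1 / (p + 1)\<close>.\<close>
      have "f (3/2) = 1" using f by (simp add: unit_cdfs_def)
      then show "f (3 * x) / (p + 1) = 1 - p / (p + 1) * f (3 - 3 * x)"
        using p_pos unfolding x by (simp add: divide_simps)
    qed
  qed (use p_pos in \<open>auto intro!: continuous_intros c'\<close>)
  then show ?thesis unfolding U[symmetric] cantor_step_def .
qed

text \<open>The mass of the heavier of the two outer thirds, \<open>1 / (p + 1)\<close> on the left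
  and \<open>p / (p + 1)\<close> on the right.\<close>

definition cantor_ratio :: real where "cantor_ratio = max 1 p / (p + 1)"

lemma cantor_ratio_bounds:
  "0 < cantor_ratio" "cantor_ratio < 1" "1 / (p+1) \<le> cantor_ratio" "p / (p+1) \<le> cantor_ratio"
  using p_pos by (auto simp: cantor_ratio_def divide_right_mono)

lemma cantor_step_contraction:
  assumes "\<And>x. \<bar>f x - g x\<bar> \<le> d"
  shows "\<bar>cantor_step p f x - cantor_step p g x\<bar> \<le> cantor_ratio * d"
proof (cases "x \<le> 1/2")
  case True
  then have "\<bar>cantor_step p f x - cantor_step p g x\<bar> = 1/(p+1) * \<bar>f (3*x) - g (3*x)\<bar>"
    using p_pos by (simp add: cantor_step_def abs_mult flip: diff_divide_distrib)
  also have "\<dots> \<le> cantor_ratio * d"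
    using assms cantor_ratio_bounds p_pos by (intro mult_mono) auto
  finally show ?thesis .
next
  case False
  then have "cantor_step p f x - cantor_step p g x = - (p/(p+1) * (f (3-3*x) - g (3-3*x)))"
    by (simp add: cantor_step_def algebra_simps)
  then have "\<bar>cantor_step p f x - cantor_step p g x\<bar> = p/(p+1) * \<bar>f (3-3*x) - g (3-3*x)\<bar>"
    using p_pos by (simp add: abs_mult)
  also have "\<dots> \<le> cantor_ratio * d"
    using assms cantor_ratio_bounds p_pos by (intro mult_mono) auto
  finally show ?thesis .
qed

lemma cantor_step_iterate_dist:
  assumes "f \<in> unit_cdfs" "g \<in> unit_cdfs"
  shows "\<bar>(cantor_step p ^^ n) f x - (cantor_step p ^^ n) g x\<bar> \<le> cantor_ratio ^ n"
proof (induction n arbitrary: x)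
  case 0
  show ?case using unit_cdfs_bounds[OF assms(1), of x] unit_cdfs_bounds[OF assms(2), of x] by simp
next
  case (Suc n)
  then show ?case using cantor_step_contraction by simp
qed

lemma cantor_step_fixpoint_exists:
  "\<exists>F \<in> unit_cdfs. continuous_on UNIV F \<and> cantor_step p F = F"
proof -
  \<comment> \<open>The iteration starts at the uniform distribution on \<open>[0,1]\<close>, which
    is continuous, so every iterate is.\<close>
  define f0 :: "real \<Rightarrow> real" where "f0 x = max 0 (min 1 x)" for x
  define f where "f n = (cantor_step p ^^ n) f0" for n
  have f0: "f0 \<in> unit_cdfs" by (auto simp: unit_cdfs_def f0_def mono_def)
  have f: "f n \<in> unit_cdfs" for n
    unfolding f_def using f0 by (rule cantor_step_iterate_unit_cdfs)
  have cont: "continuous_on UNIV (f n)" for n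
  proof (induction n)
    case 0
    show ?case unfolding f_def f0_def by (auto intro!: continuous_intros)
  next
    case (Suc n)
    then show ?case using cantor_step_continuous[OF f] by (simp add: f_def)
  qed
  \<comment> \<open>\<open>f (n + k)\<close> and \<open>f n\<close> are the \<open>n\<close>-fold
    images of \<open>f k\<close> and \<open>f0\<close>, which differ by at most 1.\<close>
  have d: "dist (f (n + k) x) (f n x) \<le> cantor_ratio ^ n" for n k x
    using cantor_step_iterate_dist[OF f[of k] f0, of n x]
    by (simp add: f_def dist_real_def funpow_add)
  have "uniformly_Cauchy_on UNIV f"
    unfolding uniformly_Cauchy_on_def
  proof (intro allI impI)
    fix e :: real assume "e > 0"
    then obtain N where N: "cantor_ratio ^ N < e / 2"
      using real_arch_pow_inv[of "e/2" cantor_ratio] cantor_ratio_bounds by auto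
    have "dist (f m x) (f n x) < e" if "m \<ge> N" "n \<ge> N" for m n x
      using d[of N "m - N" x] d[of N "n - N" x] that N dist_triangle2[of "f m x" "f n x" "f N x"] by simp
    then show "\<exists>M. \<forall>x\<in>UNIV. \<forall>m\<ge>M. \<forall>n\<ge>M. dist (f m x) (f n x) < e" by blast
  qed
  then obtain F where F: "uniform_limit UNIV f F sequentially"
    using Cauchy_uniformly_convergent uniformly_convergent_on_def by blast
  have lim: "(\<lambda>n. f n x) \<longlonglongrightarrow> F x" for x
    using tendsto_uniform_limitI[OF F] by simp
  have "continuous_on UNIV F"
    using uniform_limit_theorem[OF _ F] cont by simp
  moreover have "F \<in> unit_cdfs"
    unfolding unit_cdfs_def
  proof (intro CollectI conjI monoI allI impI)
    fix x y :: real
    assume "x \<le> y"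
    then have "f n x \<le> f n y" for n using f by (auto simp: unit_cdfs_def monoD)
    then show "F x \<le> F y" using LIMSEQ_le[OF lim lim] by blast
  next
    fix x :: real
    assume "x \<le> 0"
    then have "f n x = 0" for n using f by (auto simp: unit_cdfs_def)
    then show "F x = 0" using lim[of x] by (simp add: LIMSEQ_const_iff)
  next
    fix x :: real
    assume "x \<ge> 1"
    then have "f n x = 1" for n using f by (auto simp: unit_cdfs_def)
    then show "F x = 1" using lim[of x] by (simp add: LIMSEQ_const_iff)
  qed
  moreover have "cantor_step p F x = F x" for x
  proof -
    have "(\<lambda>n. cantor_step p (f n) x) \<longlonglongrightarrow> cantor_step p F x"
      unfolding cantor_step_def using p_pos
      by (cases "x \<le> 1/2") (auto intro!: tendsto_intros lim)
    moreover have "cantor_step p (f n) = f (Suc n)" for n by (simp add: f_def)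
    ultimately have "(\<lambda>n. f (Suc n) x) \<longlonglongrightarrow> cantor_step p F x" by simp
    then show ?thesis using LIMSEQ_Suc[OF lim[of x]] LIMSEQ_unique by blast
  qed
  ultimately show ?thesis by blast
qed

lemma cantor_step_fixpoint_unique:
  assumes "F \<in> unit_cdfs" "G \<in> unit_cdfs" "cantor_step p F = F" "cantor_step p G = G"
  shows "F = G"
proof
  fix x
  have i: "(cantor_step p ^^ n) H = H" if "cantor_step p H = H" for H n
    using that by (induction n) auto
  have "\<bar>F x - G x\<bar> \<le> cantor_ratio ^ n" for n
    using cantor_step_iterate_dist[OF assms(1,2), of n x] i assms(3,4) by simp
  moreover have "(\<lambda>n. cantor_ratio ^ n) \<longlonglongrightarrow> 0" using cantor_ratio_bounds by (intro LIMSEQ_realpow_zero) auto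
  ultimately have "\<bar>F x - G x\<bar> \<le> 0" by (intro LIMSEQ_le_const) auto
  then show "F x = G x" by simp
qed

text \<open>Turns the description under \<open>THE\<close> into a fixed-point problem. Forwards, (a)
  and (b) fix the values at 0, 1, \<open>1/3\<close> and \<open>2/3\<close>, and monotonicity fills
  in the middle third.\<close>

lemma cantor_cdf_axioms_iff_fixpoint:
  "(mono_on {0..1} F \<and>
      (\<forall>x\<in>{0..1}. F (x / 3) = F x / (p + 1)) \<and>
      (\<forall>x\<in>{0..1/3}. F (1 - x) = 1 - p * F x) \<and>
      (\<forall>x<0. F x = 0) \<and> (\<forall>x>1. F x = 1)) \<longleftrightarrow> F \<in> unit_cdfs \<and> cantor_step p F = F"
  (is "?A \<longleftrightarrow> ?B")
proof
  assume A: ?A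
  have a: "F (x / 3) = F x / (p + 1)" if "0 \<le> x" "x \<le> 1" for x using A that by simp
  have b: "F (1 - x) = 1 - p * F x" if "0 \<le> x" "x \<le> 1/3" for x using A that by simp
  have m: "F x \<le> F y" if "0 \<le> x" "x \<le> y" "y \<le> 1" for x y
    using A that by (auto simp: mono_on_def)
  have F0: "F 0 = 0" using a[of 0] p_pos by (simp add: field_simps)
  have F1: "F 1 = 1" using b[of 0] F0 by simp
  have lo: "F x = 0" if "x \<le> 0" for x using A F0 that by (cases "x = 0") auto
  have hi: "F x = 1" if "x \<ge> 1" for x using A F1 that by (cases "x = 1") auto
  have third: "F (1/3) = 1 / (p+1)" using a[of 1] F1 by simp
  have tthird: "F (2/3) = 1 / (p+1)" using b[of "1/3"] third p_pos by (simp add: field_simps)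
  have mid: "F x = 1 / (p+1)" if "1/3 \<le> x" "x \<le> 2/3" for x
    using m[of "1/3" x] m[of x "2/3"] third tthird that by simp
  have "F x \<le> F y" if "x \<le> y" for x y
  proof -
    consider "x \<le> 0" "y \<le> 0" | "x \<le> 0" "0 \<le> y" "y \<le> 1" | "x \<le> 0" "1 \<le> y"
      | "0 \<le> x" "y \<le> 1" | "0 \<le> x" "x \<le> 1" "1 \<le> y" | "1 \<le> x" "1 \<le> y" using \<open>x \<le> y\<close> by linarith
    then show ?thesis
      by cases (use m[of 0 y] m[of x 1] m[of x y] F0 F1 lo hi that in auto)
  qed
  then have "F \<in> unit_cdfs" using lo hi by (auto simp: unit_cdfs_def mono_def)
  moreover have "cantor_step p F x = F x" for x
  proof -
    consider "x \<le> 0" | "0 \<le> x" "x \<le> 1/3" | "1/3 \<le> x" "x \<le> 2/3" | "2/3 \<le> x" "x \<le> 1" | "x \<ge> 1"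
      by linarith
    then show ?thesis
    proof cases
      case 1
      then show ?thesis by (simp add: cantor_step_def lo)
    next
      case 2
      then show ?thesis using a[of "3*x"] by (simp add: cantor_step_def)
    next
      case 3
      then show ?thesis using p_pos by (simp add: cantor_step_def mid hi field_simps)
    next
      case 4
      \<comment> \<open>Condition (b) reflects \<open>x\<close> into the left third, and (a) then
        enlarges it.\<close>
      then show ?thesis using b[of "1-x"] a[of "3-3*x"] by (simp add: cantor_step_def diff_divide_distrib)
    next
      case 5
      then show ?thesis by (simp add: cantor_step_def hi lo)
    qed
  qed
  ultimately show ?B by blast
next
  assume B: ?B
  then have lo: "\<And>x. x \<le> 0 \<Longrightarrow> F x = 0" and hi: "\<And>x. x \<ge> 1 \<Longrightarrow> F x = 1" and "mono F"
    by (auto simp: unit_cdfs_def)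
  have s: "F x = cantor_step p F x" for x using B by simp
  have "F (x / 3) = F x / (p + 1)" if "x \<in> {0..1}" for x
    using that s[of "x/3"] by (simp add: cantor_step_def)
  moreover have "F (1 - x) = 1 - p * F x" if "x \<in> {0..1/3}" for x
    using that s[of "1-x"] s[of x] by (simp add: cantor_step_def)
  ultimately show ?A using lo hi \<open>mono F\<close> by (auto simp: mono_on_def monoD)
qed

lemma cantor_cdf_fixpoint:
  "cantor_cdf p \<in> unit_cdfs" "cantor_step p (cantor_cdf p) = cantor_cdf p"
  "continuous_on UNIV (cantor_cdf p)"
proof -
  obtain F where F: "F \<in> unit_cdfs" "continuous_on UNIV F" "cantor_step p F = F"
    using cantor_step_fixpoint_exists by blast
  have "cantor_cdf p = F"
    unfolding cantor_cdf_def cantor_cdf_axioms_iff_fixpoint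
    using F cantor_step_fixpoint_unique by (intro the_equality) auto
  then show "cantor_cdf p \<in> unit_cdfs" "cantor_step p (cantor_cdf p) = cantor_cdf p"
    "continuous_on UNIV (cantor_cdf p)" using F by auto
qed

subsection \<open>Self-similarity of the distribution function\<close>

private abbreviation "F \<equiv> cantor_cdf p"

lemma cantor_cdf_mono: "x \<le> y \<Longrightarrow> F x \<le> F y"
  using cantor_cdf_fixpoint(1) by (auto simp: unit_cdfs_def monoD)

lemma cantor_cdf_lower: "x \<le> 0 \<Longrightarrow> F x = 0"
  and cantor_cdf_upper: "x \<ge> 1 \<Longrightarrow> F x = 1"
  using cantor_cdf_fixpoint(1) by (auto simp: unit_cdfs_def)

lemma cantor_cdf_nonneg: "0 \<le> F x" and cantor_cdf_le_1: "F x \<le> 1"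
  using unit_cdfs_bounds[OF cantor_cdf_fixpoint(1)] by auto

lemma cantor_cdf_continuous: "continuous_on A F"
  using cantor_cdf_fixpoint(3) continuous_on_subset by blast

text \<open>Both rules hold on the whole middle third, where \<open>3 * x\<close> and
  \<open>3 - 3 * x\<close> are at least 1. This overlap leaves room for a neighbourhood of any point
  to be treated by a single rule.\<close>

lemma cantor_cdf_left: "x \<le> 2/3 \<Longrightarrow> F x = F (3 * x) / (p + 1)"
  and cantor_cdf_right: "x \<ge> 1/3 \<Longrightarrow> F x = 1 - p / (p + 1) * F (3 - 3 * x)"
proof -
  have s: "F x = (if x \<le> 1/2 then F (3 * x) / (p + 1) else 1 - p / (p + 1) * F (3 - 3 * x))"
    by (metis cantor_cdf_fixpoint(2) cantor_step_def)
  have e: "1 - p / (p + 1) = 1 / (p + 1)" using p_pos by (simp add: divide_simps)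
  show "F x = F (3 * x) / (p + 1)" if "x \<le> 2/3"
    using s that cantor_cdf_upper[of "3*x"] cantor_cdf_upper[of "3-3*x"] e by (simp split: if_splits)
  show "F x = 1 - p / (p + 1) * F (3 - 3 * x)" if "x \<ge> 1/3"
    using s that cantor_cdf_upper[of "3*x"] cantor_cdf_upper[of "3-3*x"] e by (simp split: if_splits)
qed

lemma cantor_cdf_shrink: "x \<le> 2 \<Longrightarrow> F (x / 3) = F x / (p + 1)"
  and cantor_cdf_shrink_reflect: "x \<le> 2 \<Longrightarrow> F (1 - x / 3) = 1 - p / (p + 1) * F x"
  using cantor_cdf_left[of "x/3"] cantor_cdf_right[of "1 - x/3"] by (simp_all add: algebra_simps)

text \<open>How the mass of an interval scales under the contraction onto the left third and the
  reflecting contraction onto the right third.\<close>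

lemma cantor_cdf_shrink_diff:
  assumes "a \<le> 2" "b \<le> 2"
  shows "F (b / 3) - F (a / 3) = 1 / (p + 1) * (F b - F a)"
    "F (1 - a / 3) - F (1 - b / 3) = p / (p + 1) * (F b - F a)"
  using assms by (simp_all only: cantor_cdf_shrink cantor_cdf_shrink_reflect)
    (simp_all add: algebra_simps diff_divide_distrib)

lemma cantor_cdf_mid: "1/3 \<le> x \<Longrightarrow> x \<le> 2/3 \<Longrightarrow> F x = 1 / (p + 1)"
  using cantor_cdf_left[of x] cantor_cdf_upper[of "3*x"] by simp

text \<open>Starting from \<open>F 1 = 1\<close>, each division of the argument by 3 divides the
  value by \<open>p + 1\<close>, so \<open>F\<close> is positive at points arbitrarily close to
  0.\<close>

lemma cantor_cdf_pos:
  assumes "x > 0"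
  shows "F x > 0"
proof -
  obtain n where n: "(1/3) ^ n < x" using assms real_arch_pow_inv[of x "1/3"] by auto
  have "F ((1/3) ^ n) > 0"
  proof (induction n)
    case 0
    show ?case by (simp add: cantor_cdf_upper)
  next
    case (Suc n)
    have "(1/3::real) ^ n \<le> 1" by (simp add: power_le_one)
    then show ?case using cantor_cdf_left[of "(1/3) ^ Suc n"] Suc p_pos by simp
  qed
  then show ?thesis using cantor_cdf_mono[of "(1/3) ^ n" x] n by simp
qed

lemma cantor_cdf_less_1:
  assumes "x < 1"
  shows "F x < 1"
proof (cases "x \<le> 2/3")
  case True
  have "F x \<le> 1 / (p + 1)" using cantor_cdf_mono[of x "2/3"] cantor_cdf_mid[of "2/3"] True by simp
  also have "\<dots> < 1" using p_pos by simp
  finally show ?thesis .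
next
  case False
  then show ?thesis using cantor_cdf_right[of x] cantor_cdf_pos[of "3-3*x"] assms p_pos by simp
qed

text \<open>A point missing stage \<open>Suc n\<close> is enlarged, by \<open>3 * x\<close> or
  \<open>3 - 3 * x\<close>, to a point missing stage \<open>n\<close>; outside \<open>[0,1]\<close>
  the claim is clear.\<close>

lemma cantor_cdf_locally_constant:
  assumes "x \<notin> cantor_stage n"
  shows "\<exists>e>0. \<forall>y. \<bar>y - x\<bar> < e \<longrightarrow> F y = F x"
  using assms
proof (induction n arbitrary: x)
  case 0
  then consider "x < 0" | "x > 1" by force
  then show ?case
  proof cases
    case 1
    then show ?thesis by (intro exI[of _ "-x"]) (auto simp: cantor_cdf_lower)
  next
    case 2
    then show ?thesis by (intro exI[of _ "x-1"]) (auto simp: cantor_cdf_upper)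
  qed
next
  case (Suc n)
  show ?case
  proof (cases "x \<le> 1/2")
    case True
    have "3 * x \<notin> cantor_stage n"
    proof
      assume "3 * x \<in> cantor_stage n"
      from cantor_stage_SucI(1)[OF this] show False using Suc.prems by simp
    qed
    then obtain e where e: "e > 0" "\<And>y. \<bar>y - 3 * x\<bar> < e \<Longrightarrow> F y = F (3 * x)"
      using Suc.IH by blast
    \<comment> \<open>The radius \<open>1/6\<close> keeps \<open>y\<close> below \<open>2/3\<close>,
      within reach of the rule used for \<open>x\<close>.\<close>
    have "F y = F x" if "\<bar>y - x\<bar> < min (e/3) (1/6)" for y
    proof -
      have "\<bar>3 * y - 3 * x\<bar> < e" "y \<le> 2/3" using that True by linarith+
      then show ?thesis
        using True cantor_cdf_left[of x] cantor_cdf_left[of y] e(2)[of "3 * y"] by simp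
    qed
    moreover have "min (e/3) (1/6) > 0" using e(1) by simp
    ultimately show ?thesis by blast
  next
    case False
    have "3 - 3 * x \<notin> cantor_stage n"
    proof
      assume "3 - 3 * x \<in> cantor_stage n"
      from cantor_stage_SucI(2)[OF cantor_stage_reflect[OF this]]
      show False using Suc.prems by (simp add: field_simps)
    qed
    then obtain e where e: "e > 0" "\<And>y. \<bar>y - (3 - 3 * x)\<bar> < e \<Longrightarrow> F y = F (3 - 3 * x)"
      using Suc.IH by blast
    have "F y = F x" if "\<bar>y - x\<bar> < min (e/3) (1/6)" for y
    proof -
      have "\<bar>(3 - 3 * y) - (3 - 3 * x)\<bar> < e" "1/3 \<le> y" using that False by linarith+
      then show ?thesis
        using False cantor_cdf_right[of x] cantor_cdf_right[of y] e(2)[of "3 - 3*y"] by simp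
    qed
    moreover have "min (e/3) (1/6) > 0" using e(1) by simp
    ultimately show ?thesis by blast
  qed
qed

subsection \<open>Failure of the Lipschitz condition on the Cantor set\<close>

text \<open>For the nondecreasing \<open>F\<close> this is the usual Lipschitz condition without
  absolute values.\<close>

definition cdf_lipschitz_on :: "real \<Rightarrow> real set \<Rightarrow> bool" where
  "cdf_lipschitz_on K A \<longleftrightarrow> (\<forall>a\<in>A. \<forall>b\<in>A. a \<le> b \<longrightarrow> F b - F a \<le> K * (b - a))"

lemma cdf_lipschitz_onD:
  "cdf_lipschitz_on K A \<Longrightarrow> a \<in> A \<Longrightarrow> b \<in> A \<Longrightarrow> a \<le> b \<Longrightarrow> F b - F a \<le> K * (b - a)"
  by (simp add: cdf_lipschitz_on_def)

text \<open>Undoing one contraction triples the window around the point and changes only the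
  constant. After \<open>n\<close> of them the radius exceeds 1, so the window covers
  \<open>[0,1]\<close>.\<close>

lemma cdf_lipschitz_on_zoom:
  assumes "x \<in> cantor_stage n" "(1/3)^n < e" "cdf_lipschitz_on K ({0..1} \<inter> {x-e<..<x+e})"
  shows "\<exists>K. cdf_lipschitz_on K {0..1}"
  using assms
proof (induction n arbitrary: x e K)
  case 0
  then have "{0..1} \<inter> {x-e<..<x+e} = {0..1}" by auto
  with 0 show ?case by auto
next
  case (Suc n)
  \<comment> \<open>Here \<open>w\<close> is the weight of the contraction being undone: lengths
    grow by the factor 3, masses by \<open>1 / w\<close>.\<close>
  have scale: "cdf_lipschitz_on (K / (3 * w)) ({0..1} \<inter> {y-3*e<..<y+3*e})"
    if "w > 0" and le: "\<And>a b. a \<in> {0..1} \<inter> {y-3*e<..<y+3*e} \<Longrightarrow> b \<in> {0..1} \<inter> {y-3*e<..<y+3*e} \<Longrightarrow>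
      a \<le> b \<Longrightarrow> w * (F b - F a) \<le> K * ((b - a) / 3)" for w y
    unfolding cdf_lipschitz_on_def
  proof (intro ballI impI)
    fix a b assume "a \<in> {0..1} \<inter> {y-3*e<..<y+3*e}" "b \<in> {0..1} \<inter> {y-3*e<..<y+3*e}" "a \<le> b"
    from le[OF this] have "F b - F a \<le> K * ((b - a) / 3) / w"
      using \<open>w > 0\<close> by (simp add: pos_le_divide_eq mult.commute)
    then show "F b - F a \<le> K / (3 * w) * (b - a)" by simp
  qed
  consider y where "y \<in> cantor_stage n" "x = y / 3" | y where "y \<in> cantor_stage n" "x = 2/3 + y / 3"
    using Suc.prems(1) by auto
  then show ?case
  proof cases
    case 1
    have "1 / (p + 1) * (F b - F a) \<le> K * ((b - a) / 3)"
      if ab: "a \<in> {0..1} \<inter> {y-3*e<..<y+3*e}" "b \<in> {0..1} \<inter> {y-3*e<..<y+3*e}" "a \<le> b" for a b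
    proof -
      have "a / 3 \<in> {0..1} \<inter> {x-e<..<x+e}" "b / 3 \<in> {0..1} \<inter> {x-e<..<x+e}"
        using 1 ab by auto
      from cdf_lipschitz_onD[OF Suc.prems(3) this] ab cantor_cdf_shrink_diff(1)[of a b]
      show ?thesis by (simp add: diff_divide_distrib)
    qed
    then have "cdf_lipschitz_on (K / (3 * (1 / (p + 1)))) ({0..1} \<inter> {y-3*e<..<y+3*e})"
      using p_pos by (intro scale) auto
    then show ?thesis using Suc.IH[OF 1(1), of "3*e"] Suc.prems(2) by simp
  next
    case 2
    \<comment> \<open>The window is centred at \<open>1 - y\<close> because
      \<open>x = 1 - (1 - y) / 3\<close> and the right-hand rule reflects.\<close>
    have "p / (p + 1) * (F b - F a) \<le> K * ((b - a) / 3)"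
      if ab: "a \<in> {0..1} \<inter> {(1-y)-3*e<..<(1-y)+3*e}"
        "b \<in> {0..1} \<inter> {(1-y)-3*e<..<(1-y)+3*e}" "a \<le> b" for a b
    proof -
      have "1 - b / 3 \<in> {0..1} \<inter> {x-e<..<x+e}" "1 - a / 3 \<in> {0..1} \<inter> {x-e<..<x+e}"
        using 2 ab by auto
      from cdf_lipschitz_onD[OF Suc.prems(3) this] ab cantor_cdf_shrink_diff(2)[of a b]
      show ?thesis by (simp add: diff_divide_distrib)
    qed
    then have "cdf_lipschitz_on (K / (3 * (p / (p + 1)))) ({0..1} \<inter> {(1-y)-3*e<..<(1-y)+3*e})"
      using p_pos by (intro scale) auto
    then show ?thesis using Suc.IH[OF cantor_stage_reflect[OF 2(1)], of "3*e"] Suc.prems(2) by simp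
  qed
qed

lemma not_cdf_lipschitz_on_unit: "\<not> cdf_lipschitz_on K {0..1}"
proof
  text \<open>The heavier third carries at least half of the mass, so rescaling it shrinks every
    Lipschitz constant by the factor \<open>2/3\<close>.\<close>
  have improve: "cdf_lipschitz_on (2/3 * L) {0..1}" if L: "cdf_lipschitz_on L {0..1}" for L
    unfolding cdf_lipschitz_on_def
  proof (intro ballI impI)
    fix a b :: real assume ab: "a \<in> {0..1}" "b \<in> {0..1}" "a \<le> b"
    have d: "0 \<le> F b - F a" using cantor_cdf_mono ab by simp
    have "1/2 * (F b - F a) \<le> L * ((b - a) / 3)"
    proof (cases "p \<le> 1")
      case True
      have "1/2 * (F b - F a) \<le> 1 / (p + 1) * (F b - F a)"
        using d True p_pos by (intro mult_right_mono) (auto simp: divide_simps)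
      also have "\<dots> = F (b/3) - F (a/3)" using cantor_cdf_shrink_diff(1)[of a b] ab by simp
      also have "\<dots> \<le> L * (b/3 - a/3)" using ab by (intro cdf_lipschitz_onD[OF L]) auto
      finally show ?thesis by (simp add: diff_divide_distrib)
    next
      case False
      have "1/2 * (F b - F a) \<le> p / (p + 1) * (F b - F a)"
        using d False p_pos by (intro mult_right_mono) (auto simp: divide_simps)
      also have "\<dots> = F (1 - a/3) - F (1 - b/3)" using cantor_cdf_shrink_diff(2)[of a b] ab by simp
      also have "\<dots> \<le> L * ((1 - a/3) - (1 - b/3))" using ab by (intro cdf_lipschitz_onD[OF L]) auto
      finally show ?thesis by (simp add: diff_divide_distrib)
    qed
    then show "F b - F a \<le> 2/3 * L * (b - a)" by simp
  qed
  assume K: "cdf_lipschitz_on K {0..1}"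
  have "cdf_lipschitz_on ((2/3)^n * K) {0..1}" for n
    by (induction n) (use K improve in \<open>auto simp: mult.assoc\<close>)
  then have "1 \<le> (2/3)^n * K" for n
    using cdf_lipschitz_onD[of "(2/3)^n * K" "{0..1}" 0 1] by (simp add: cantor_cdf_lower cantor_cdf_upper)
  moreover have "(\<lambda>n. (2/3::real)^n * K) \<longlonglongrightarrow> 0 * K"
    by (intro tendsto_mult LIMSEQ_realpow_zero tendsto_const) auto
  ultimately show False using LIMSEQ_le_const by fastforce
qed

lemma not_in_cantor_set_if_locally_lipschitz:
  assumes "e > 0" "cdf_lipschitz_on K {x-e<..<x+e}"
  shows "x \<notin> cantor_set"
proof
  assume x: "x \<in> cantor_set"
  obtain n where "(1/3)^n < e" using assms(1) real_arch_pow_inv[of e "1/3"] by auto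
  moreover have "x \<in> cantor_stage n" using x by (simp add: cantor_set_def)
  moreover have "cdf_lipschitz_on K ({0..1} \<inter> {x-e<..<x+e})"
    using assms(2) by (auto simp: cdf_lipschitz_on_def)
  ultimately show False using cdf_lipschitz_on_zoom not_cdf_lipschitz_on_unit by blast
qed

subsection \<open>The integrated distribution function\<close>

text \<open>The integral starts at \<open>-1\<close> so that the derivative at \<open>0\<close> is two-sided.\<close>
definition cdf_primitive :: "real \<Rightarrow> real" where
  "cdf_primitive x = integral {-1..x} F"

private abbreviation "\<Phi> \<equiv> cdf_primitive"

lemma cdf_primitive_0: "\<Phi> 0 = 0"
proof -
  have "(F has_integral 0) {-1..0}"
    by (rule has_integral_is_0) (simp add: cantor_cdf_lower)
  then show ?thesis by (simp add: cdf_primitive_def integral_unique)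
qed

lemma cdf_primitive_deriv:
  assumes "x > -1"
  shows "(\<Phi> has_real_derivative F x) (at x within A)"
proof -
  have e: "(\<lambda>y. integral {-1..y} F) = \<Phi>" by (simp add: fun_eq_iff cdf_primitive_def)
  have "(\<Phi> has_real_derivative F x) (at x within {-1..x+1})"
    using integral_has_real_derivative[of "-1" "x+1" F x] assms cantor_cdf_continuous
    unfolding e by simp
  then have "(\<Phi> has_real_derivative F x) (at x within {-1<..<x+1})"
    by (rule DERIV_subset) auto
  moreover have "at x within {-1<..<x+1} = at x"
    using assms by (intro at_within_open) auto
  ultimately have "(\<Phi> has_real_derivative F x) (at x)" by simp
  then show ?thesis by (rule has_field_derivative_at_within)
qed

text \<open>Mean value theorem and monotonicity of \<open>F\<close>. Where \<open>F a = F b\<close>,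
  the two bounds give the exact increment.\<close>

lemma cdf_primitive_diff_bounds:
  assumes "-1 < a" "a \<le> b"
  shows "(b - a) * F a \<le> \<Phi> b - \<Phi> a" "\<Phi> b - \<Phi> a \<le> (b - a) * F b"
proof -
  have "\<exists>z. a \<le> z \<and> z \<le> b \<and> \<Phi> b - \<Phi> a = (b - a) * F z"
  proof (cases "a = b")
    case False
    then have "a < b" using assms by simp
    from MVT2[OF this, of \<Phi> F] cdf_primitive_deriv assms
    obtain z where "a < z" "z < b" "\<Phi> b - \<Phi> a = (b - a) * F z" by auto
    then show ?thesis by (intro exI[of _ z]) auto
  qed auto
  then obtain z where "a \<le> z" "z \<le> b" "\<Phi> b - \<Phi> a = (b - a) * F z" by blast
  then show "(b - a) * F a \<le> \<Phi> b - \<Phi> a" "\<Phi> b - \<Phi> a \<le> (b - a) * F b"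
    using assms cantor_cdf_mono by (auto intro!: mult_left_mono)
qed

text \<open>The two sides have equal derivatives by \<open>cantor_cdf_left\<close> and agree at
  0.\<close>

lemma cdf_primitive_left:
  assumes "0 \<le> x" "x \<le> 2/3"
  shows "\<Phi> x = \<Phi> (3 * x) / (3 * (p + 1))"
proof -
  have "\<exists>c. \<forall>x\<in>{0..2/3}. \<Phi> x - \<Phi> (3 * x) / (3 * (p + 1)) = c"
  proof (rule has_field_derivative_zero_constant)
    fix x :: real assume x: "x \<in> {0..2/3}"
    have "((\<lambda>x. \<Phi> (3 * x)) has_real_derivative F (3 * x) * 3) (at x within {0..2/3})"
      using x by (intro DERIV_chain2[OF cdf_primitive_deriv]) (auto intro!: derivative_eq_intros)
    then have "((\<lambda>x. \<Phi> x - \<Phi> (3 * x) / (3 * (p + 1))) has_real_derivative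
        F x - F (3 * x) * 3 / (3 * (p + 1))) (at x within {0..2/3})"
      using x by (intro DERIV_diff DERIV_cdivide cdf_primitive_deriv) auto
    moreover have "F x - F (3 * x) * 3 / (3 * (p + 1)) = 0"
      using x cantor_cdf_left[of x] p_pos by (simp add: divide_simps) (simp add: algebra_simps)
    ultimately show "((\<lambda>x. \<Phi> x - \<Phi> (3 * x) / (3 * (p + 1))) has_real_derivative 0) (at x within {0..2/3})"
      by simp
  qed simp
  then have "\<Phi> x - \<Phi> (3 * x) / (3 * (p + 1)) = \<Phi> 0 - \<Phi> (3 * 0) / (3 * (p + 1))"
    using assms by force
  then show ?thesis by (simp add: cdf_primitive_0)
qed

text \<open>The same argument with \<open>cantor_cdf_right\<close>, anchored at 1, where
  \<open>3 - 3 * x\<close> is 0.\<close>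

lemma cdf_primitive_right:
  assumes "1/3 \<le> x" "x \<le> 1"
  shows "\<Phi> x = \<Phi> 1 - (1 - x) + p / (3 * (p + 1)) * \<Phi> (3 - 3 * x)"
proof -
  let ?f = "\<lambda>x. \<Phi> x - x - p / (3 * (p + 1)) * \<Phi> (3 - 3 * x)"
  have "\<exists>c. \<forall>x\<in>{1/3..1}. ?f x = c"
  proof (rule has_field_derivative_zero_constant)
    fix x :: real assume x: "x \<in> {1/3..1}"
    have "((\<lambda>x. \<Phi> (3 - 3 * x)) has_real_derivative F (3 - 3 * x) * (-3)) (at x within {1/3..1})"
      using x by (intro DERIV_chain2[OF cdf_primitive_deriv]) (auto intro!: derivative_eq_intros)
    then have "(?f has_real_derivative F x - 1 - p / (3 * (p + 1)) * (F (3 - 3 * x) * (-3)))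
        (at x within {1/3..1})"
      using x by (intro DERIV_diff DERIV_cmult DERIV_ident cdf_primitive_deriv) auto
    moreover have "F x - 1 - p / (3 * (p + 1)) * (F (3 - 3 * x) * (-3)) = 0"
      using x cantor_cdf_right[of x] p_pos by (simp add: divide_simps) (simp add: algebra_simps)
    ultimately show "(?f has_real_derivative 0) (at x within {1/3..1})"
      by simp
  qed simp
  then obtain c where c: "\<And>x. x \<in> {1/3..1} \<Longrightarrow> ?f x = c" by blast
  have "?f x = ?f 1" using c[of x] c[of 1] assms by simp
  then show ?thesis by (simp add: cdf_primitive_0)
qed

text \<open>Both rules apply at \<open>2/3\<close>, and equating them gives a linear equation for
  \<open>\<Phi> 1\<close>.\<close>

lemma cdf_primitive_1: "\<Phi> 1 = (p + 2) / (4 * p + 2)"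
proof -
  have "\<Phi> 2 = \<Phi> 1 + 1"
    using cdf_primitive_diff_bounds[of 1 2] cantor_cdf_upper[of 1] cantor_cdf_upper[of 2] by simp
  then have "(\<Phi> 1 + 1) / (3 * (p + 1)) = \<Phi> 1 - 1/3 + p / (3 * (p + 1)) * \<Phi> 1"
    using cdf_primitive_left[of "2/3"] cdf_primitive_right[of "2/3"] by simp
  then have "\<Phi> 1 + 1 = (\<Phi> 1 - 1/3 + p / (3 * (p + 1)) * \<Phi> 1) * (3 * (p + 1))"
    using p_pos by (simp add: divide_eq_eq)
  also have "\<dots> = (3 * \<Phi> 1 - 1) * (p + 1) + p * \<Phi> 1"
    using p_pos by (simp add: divide_simps) (simp add: algebra_simps)
  finally have "\<Phi> 1 * (4 * p + 2) = p + 2" by (simp add: algebra_simps)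
  then show ?thesis using p_pos by (simp add: eq_divide_eq)
qed

text \<open>On \<open>[0,1]\<close> this is the numerator of the mean residual life; writing it
  through \<open>\<Phi>\<close> carries over the self-similarity and the increment bounds.\<close>

definition tail_integral :: "real \<Rightarrow> real" where
  "tail_integral x = (1 - x) - (\<Phi> 1 - \<Phi> x)"

private abbreviation "G \<equiv> tail_integral"

lemma tail_integral_eq:
  assumes "0 \<le> x" "x \<le> 1"
  shows "integral {x..1} (\<lambda>u. 1 - F u) = G x"
proof -
  have "((\<lambda>u. 1 - F u) has_integral (1 - \<Phi> 1) - (x - \<Phi> x)) {x..1}"
    using assms by (intro fundamental_theorem_of_calculus)
      (auto intro!: derivative_eq_intros cdf_primitive_deriv
        simp flip: has_real_derivative_iff_has_vector_derivative)
  then show ?thesis by (simp add: integral_unique tail_integral_def)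
qed

lemma tail_integral_diff_bounds:
  assumes "0 \<le> a" "a \<le> b"
  shows "(b - a) * (1 - F b) \<le> G a - G b" "G a - G b \<le> (b - a) * (1 - F a)"
  using cdf_primitive_diff_bounds[of a b] assms by (auto simp: tail_integral_def algebra_simps)

lemma tail_integral_1: "G 1 = 0" by (simp add: tail_integral_def)

lemma tail_integral_antimono: "0 \<le> a \<Longrightarrow> a \<le> b \<Longrightarrow> G b \<le> G a"
  using tail_integral_diff_bounds(1)[of a b] cantor_cdf_le_1[of b]
    mult_nonneg_nonneg[of "b - a" "1 - F b"] by linarith

lemma tail_integral_nonneg: "0 \<le> x \<Longrightarrow> x \<le> 1 \<Longrightarrow> 0 \<le> G x"
  using tail_integral_antimono[of x 1] tail_integral_1 by simp

lemma tail_integral_pos: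
  assumes "0 \<le> x" "x < 1"
  shows "0 < G x"
proof -
  let ?y = "(x + 1) / 2"
  have "0 < (?y - x) * (1 - F ?y)" using assms cantor_cdf_less_1[of ?y] by simp
  also have "\<dots> \<le> G x - G ?y" using assms by (intro tail_integral_diff_bounds) auto
  also have "\<dots> \<le> G x" using assms tail_integral_nonneg[of ?y] by simp
  finally show ?thesis .
qed

lemma tail_integral_continuous: "continuous_on {0..} G"
proof -
  have "continuous_on {0..} \<Phi>"
    by (rule DERIV_continuous_on[where D = F], rule cdf_primitive_deriv) auto
  then show ?thesis unfolding tail_integral_def by (intro continuous_intros)
qed

section \<open>Bounds and continuity of the mean residual life\<close>

lemma mrl_eq: "0 \<le> x \<Longrightarrow> x < 1 \<Longrightarrow> mrl p x = G x / (1 - F x)"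
  by (simp add: mrl_def tail_integral_eq)

text \<open>The upper bound holds since \<open>1 - F\<close> is nonincreasing. It gives continuity
  at 1, where the quotient degenerates, and puts \<open>mrl p\<close> below the diagonal beyond
  \<open>2/3\<close>.\<close>

lemma mrl_bounds:
  assumes "0 \<le> x" "x \<le> 1"
  shows "0 \<le> mrl p x" "mrl p x \<le> 1 - x"
proof -
  have "0 \<le> mrl p x \<and> mrl p x \<le> 1 - x"
  proof (cases "x = 1")
    case True
    then show ?thesis by (simp add: mrl_def)
  next
    case False
    then have "x < 1" using assms by simp
    moreover have "G x \<le> (1 - x) * (1 - F x)"
      using assms tail_integral_diff_bounds(2)[of x 1] by (simp add: tail_integral_1)
    ultimately show ?thesis
      using assms tail_integral_nonneg[of x] cantor_cdf_less_1[of x]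
      by (simp add: mrl_eq pos_divide_le_eq)
  qed
  then show "0 \<le> mrl p x" "mrl p x \<le> 1 - x" by auto
qed

lemma mrl_continuous: "continuous_on {0..1} (mrl p)"
  unfolding continuous_on_eq_continuous_within
proof
  fix x :: real assume x: "x \<in> {0..1}"
  show "continuous (at x within {0..1}) (mrl p)"
  proof (cases "x = 1")
    case True
    have "(mrl p \<longlongrightarrow> 0) (at 1 within {0..1})"
    proof (rule tendsto_sandwich)
      show "\<forall>\<^sub>F x in at 1 within {0..1}. 0 \<le> mrl p x" "\<forall>\<^sub>F x in at 1 within {0..1}. mrl p x \<le> 1 - x"
        using mrl_bounds by (auto simp: eventually_at_filter)
      show "((\<lambda>x::real. 1 - x) \<longlongrightarrow> 0) (at 1 within {0..1})"
        by (auto intro!: tendsto_eq_intros)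
    qed auto
    then show ?thesis using True by (simp add: continuous_within mrl_def)
  next
    case False
    have "continuous_on {0..<1} (\<lambda>x. G x / (1 - F x))"
    proof (intro continuous_on_divide continuous_on_diff continuous_on_const
        cantor_cdf_continuous continuous_on_subset[OF tail_integral_continuous])
      show "\<forall>x\<in>{0..<1}. 1 - F x \<noteq> 0" using cantor_cdf_less_1 by fastforce
    qed auto
    then have "continuous_on {0..<1} (mrl p)"
      by (rule continuous_on_eq) (simp add: mrl_eq)
    then have "continuous (at x within {0..<1}) (mrl p)"
      using x False by (simp add: continuous_on_eq_continuous_within)
    moreover have "at x within {0..<1} = at x within {0..1}"
      using x False by (intro at_within_nhd[of _ "{..<1}"]) auto
    ultimately show ?thesis by (simp add: continuous_within)
  qed
qed

lemma gmrl_continuous: "continuous_on {0<..<1} (gmrl p)"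
  unfolding gmrl_def
  by (intro continuous_intros continuous_on_subset[OF mrl_continuous]) auto

subsection \<open>Local monotonicity\<close>

text \<open>Near \<open>x\<close> the denominator \<open>1 - F\<close> is constant, while the
  numerator \<open>G\<close> is nonincreasing.\<close>

lemma mrl_locally_decreasing_outside_cantor_set:
  assumes x: "0 < x" "x < 1" "x \<notin> cantor_set"
  shows "locally_decreasing_at (mrl p) x"
proof -
  obtain n where "x \<notin> cantor_stage n" using x by (auto simp: cantor_set_def)
  then obtain e where e: "e > 0" "\<And>y. \<bar>y - x\<bar> < e \<Longrightarrow> F y = F x"
    using cantor_cdf_locally_constant by blast
  let ?U = "{x-e<..<x+e} \<inter> {0<..<1}"
  have "mrl p b \<le> mrl p a" if "a \<in> ?U" "b \<in> ?U" "a \<le> b" for a b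
  proof -
    have "F a = F x" "F b = F x" using that e(2)[of a] e(2)[of b] by (auto simp: abs_less_iff)
    then show ?thesis
      using that tail_integral_antimono[of a b] cantor_cdf_less_1[OF x(2)]
      by (simp add: mrl_eq divide_right_mono)
  qed
  then have "antimono_on ?U (mrl p)" by (simp add: monotone_on_def)
  then show ?thesis unfolding locally_decreasing_at_def
    using x e(1) by (intro exI[of _ ?U]) auto
qed

text \<open>Links the two functions, so that the converse is only required for \<open>gmrl\<close>:
  a cycle of three implications yields both equivalences.\<close>

lemma gmrl_locally_decreasing_if_mrl:
  assumes "locally_decreasing_at (mrl p) x"
  shows "locally_decreasing_at (gmrl p) x"
proof -
  obtain U where U: "open U" "x \<in> U" "U \<subseteq> {0<..<1}" "antimono_on U (mrl p)"
    using assms by (auto simp: locally_decreasing_at_def)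
  have "gmrl p b \<le> gmrl p a" if "a \<in> U" "b \<in> U" "a \<le> b" for a b
    unfolding gmrl_def
  proof (rule frac_le)
    show "mrl p b \<le> mrl p a" using U(4) that by (auto simp: monotone_on_def)
    show "0 \<le> mrl p a" using U(3) that by (intro mrl_bounds) auto
  qed (use U(3) that in auto)
  then have "antimono_on U (gmrl p)" by (simp add: monotone_on_def)
  then show ?thesis using U by (auto simp: locally_decreasing_at_def)
qed

text \<open>Cross-multiplying the inequality for \<open>gmrl\<close> bounds the increment of
  \<open>F\<close> by increments of \<open>G\<close> and of the identity, so \<open>F\<close> is
  Lipschitz near \<open>x\<close>.\<close>

lemma not_in_cantor_set_if_gmrl_locally_decreasing:
  assumes "locally_decreasing_at (gmrl p) x"
  shows "x \<notin> cantor_set"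
proof -
  obtain U where U: "open U" "x \<in> U" "U \<subseteq> {0<..<1}" "antimono_on U (gmrl p)"
    using assms by (auto simp: locally_decreasing_at_def)
  obtain e where e: "e > 0" "cball x e \<subseteq> U" using U(1,2) open_contains_cball by blast
  have "x - e \<in> cball x e" "x + e \<in> cball x e" using e(1) by (auto simp: dist_real_def)
  then have "x - e \<in> {0<..<1}" "x + e \<in> {0<..<1}" using e(2) U(3) by blast+
  then have lu: "0 < x - e" "x + e < 1" by simp_all
  \<comment> \<open>A positive lower bound for \<open>G a * a\<close> on the window, as
    \<open>G\<close> is nonincreasing there.\<close>
  define g where "g = G (x + e) * (x - e)"
  have g: "g > 0" unfolding g_def using lu e(1) by (intro mult_pos_pos tail_integral_pos) auto
  have "cdf_lipschitz_on (2 / g) {x-e<..<x+e}"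
    unfolding cdf_lipschitz_on_def
  proof (intro ballI impI)
    fix a b assume ab: "a \<in> {x-e<..<x+e}" "b \<in> {x-e<..<x+e}" "a \<le> b"
    have aU: "a \<in> U" "b \<in> U" using ab e by (auto simp: dist_real_def subset_iff)
    have r: "0 < a" "a < 1" "0 < b" "b < 1" using ab lu by auto
    have S: "0 < 1 - F a" "0 < 1 - F b" "1 - F a \<le> 1" "1 - F b \<le> 1"
      using cantor_cdf_less_1 cantor_cdf_nonneg r by auto
    have "gmrl p b \<le> gmrl p a" using U(4) aU ab by (auto simp: monotone_on_def)
    then have "G b / ((1 - F b) * b) \<le> G a / ((1 - F a) * a)"
      using r by (simp add: gmrl_def mrl_eq)
    moreover have "0 < (1 - F a) * a" "0 < (1 - F b) * b" using r S by simp_all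
    ultimately have "G b * ((1 - F a) * a) \<le> G a * ((1 - F b) * b)"
      by (simp only: pos_divide_le_eq pos_le_divide_eq times_divide_eq_left)
    \<comment> \<open>Isolates \<open>F b - F a\<close>; each of the two terms on the right is at
      most \<open>b - a\<close>, whence the constant \<open>2 / g\<close>.\<close>
    then have *: "G a * a * (F b - F a) \<le> a * (1 - F a) * (G a - G b) + G a * ((b - a) * (1 - F b))"
      by (simp add: algebra_simps)
    have Ga: "0 \<le> G a" "G a \<le> 1"
      using tail_integral_nonneg[of a] tail_integral_diff_bounds(2)[of a 1] tail_integral_1 r S
        mult_le_one[of "1 - a" "1 - F a"] by auto
    have "G a - G b \<le> (b - a) * (1 - F a)" using tail_integral_diff_bounds(2)[of a b] r ab by simp
    also have "\<dots> \<le> (b - a) * 1" using ab S by (intro mult_left_mono) auto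
    finally have "G a - G b \<le> b - a" by simp
    then have "a * (1 - F a) * (G a - G b) \<le> 1 * (b - a)"
      using r S ab tail_integral_antimono[of a b] mult_le_one[of a "1 - F a"]
      by (intro mult_mono) auto
    moreover have "G a * ((b - a) * (1 - F b)) \<le> 1 * ((b - a) * 1)"
      using Ga S ab by (intro mult_mono) auto
    moreover have "g * (F b - F a) \<le> G a * a * (F b - F a)"
      unfolding g_def using ab lu r Ga cantor_cdf_mono[of a b] tail_integral_antimono[of a "x+e"]
      by (intro mult_right_mono mult_mono) auto
    ultimately have "g * (F b - F a) \<le> 2 * (b - a)" using * by linarith
    then show "F b - F a \<le> 2 / g * (b - a)" using g by (simp add: pos_le_divide_eq mult_ac)
  qed
  then show ?thesis using not_in_cantor_set_if_locally_lipschitz[OF e(1)] by blast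
qed

lemma locally_decreasing_iff:
  assumes "x \<in> {0<..<1}"
  shows "locally_decreasing_at (mrl p) x \<longleftrightarrow> x \<in> {0..1} - cantor_set"
    "locally_decreasing_at (gmrl p) x \<longleftrightarrow> x \<in> {0..1} - cantor_set"
  using assms mrl_locally_decreasing_outside_cantor_set gmrl_locally_decreasing_if_mrl
    not_in_cantor_set_if_gmrl_locally_decreasing by auto

subsection \<open>The fixed point of the mean residual life\<close>

lemma tail_integral_shrink:
  assumes "0 \<le> y" "y \<le> 1"
  shows "3 * (p + 1) * G (y / 3) = p * (1 - y) + G y + p * (1 + \<Phi> 1)"
proof -
  have "3 * (p + 1) * \<Phi> (y / 3) = \<Phi> y"
    using cdf_primitive_left[of "y / 3"] assms p_pos by simp
  moreover have "\<Phi> 1 * (4 * p + 2) = p + 2" using p_pos by (simp add: cdf_primitive_1)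
  moreover have "3 * (p + 1) * G (y / 3)
      = 3 * (p + 1) * (1 - \<Phi> 1) - (p + 1) * y + 3 * (p + 1) * \<Phi> (y / 3)"
    by (simp add: tail_integral_def algebra_simps)
  ultimately show ?thesis unfolding tail_integral_def by (simp add: algebra_simps)
qed

lemma cdf_primitive_1_pos: "\<Phi> 1 > 0"
  using p_pos by (simp add: cdf_primitive_1)

text \<open>For \<open>y < 1\<close>, \<open>y * (1 - F y) < G y\<close> says
  \<open>y < mrl p y\<close> without denominators. After multiplication by
  \<open>3 * (p + 1)\<close>, the claim at \<open>y / 3\<close> becomes \<open>key\<close>, which
  also holds for every \<open>y\<close> from \<open>1/3\<close> on.\<close>

lemma tail_integral_above_diagonal_shrink:
  assumes y: "0 \<le> y" "y \<le> 1" and or: "1/3 \<le> y \<or> y * (1 - F y) < G y"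
  shows "y / 3 * (1 - F (y / 3)) < G (y / 3)"
proof -
  have Gy: "0 \<le> G y" using y by (rule tail_integral_nonneg)
  have key: "y * (1 - F y) < p * (2 - 2 * y + \<Phi> 1) + G y"
  proof -
    consider "y * (1 - F y) < G y" | "1/3 \<le> y" "y \<le> 2/3" | "2/3 < y" using or by linarith
    then show ?thesis
    proof cases
      case 1
      moreover have "0 \<le> p * (2 - 2 * y + \<Phi> 1)" using y p_pos cdf_primitive_1_pos by simp
      ultimately show ?thesis by simp
    next
      case 2
      have "1 - F y = p / (p + 1)"
        unfolding cantor_cdf_mid[OF 2] using p_pos by (simp add: divide_simps)
      also have "\<dots> \<le> p" using p_pos by (simp add: pos_divide_le_eq)
      finally have "1 - F y \<le> p" .
      then have "y * (1 - F y) \<le> y * p" using y by (intro mult_left_mono)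
      moreover have "0 < p * (2 - 3 * y + \<Phi> 1)" using 2 p_pos cdf_primitive_1_pos by simp
      ultimately show ?thesis using Gy by (simp add: algebra_simps)
    next
      case 3
      define z where "z = 3 - 3 * y"
      have z: "0 \<le> z" "z \<le> 1" "y = 1 - z / 3" using 3 y by (simp_all add: z_def field_simps)
      have Fz: "0 \<le> F z" "F z \<le> 1" using cantor_cdf_nonneg cantor_cdf_le_1 by auto
      have S: "1 - F y = p / (p + 1) * F z" using cantor_cdf_right[of y] 3 by (simp add: z_def)
      have "0 \<le> \<Phi> z" using cdf_primitive_diff_bounds(1)[of 0 z] z Fz cdf_primitive_0
        cantor_cdf_lower[of 0] by simp
      then have I: "(1 - z) * F z \<le> \<Phi> 1" using cdf_primitive_diff_bounds(1)[of z 1] z by simp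
      have "y * F z \<le> 2 - 2 * y + \<Phi> 1"
      proof -
        have "y * F z = 2 / 3 * z * F z + (1 - z) * F z"
          unfolding z(3) by (simp add: algebra_simps)
        also have "\<dots> \<le> 2 / 3 * z * 1 + \<Phi> 1" using z Fz I by (intro add_mono mult_left_mono) auto
        finally show ?thesis using z(3) by linarith
      qed
      then have le: "p * (y * F z) \<le> p * (2 - 2 * y + \<Phi> 1)" using p_pos by (intro mult_left_mono) auto
      show ?thesis
      \<comment> \<open>Strictness comes from \<open>\<Phi> 1 > 0\<close> if \<open>F z = 0\<close>,
        and from \<open>p / (p + 1) < p\<close> otherwise.\<close>
      proof (cases "F z = 0")
        case True
        then have "y * (1 - F y) = 0" using S by simp
        moreover have "0 < p * (2 - 2 * y + \<Phi> 1)" using y p_pos cdf_primitive_1_pos by simp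
        ultimately show ?thesis using Gy by linarith
      next
        case False
        then have pos: "0 < y * F z" using Fz 3 by simp
        have "y * (1 - F y) = p / (p + 1) * (y * F z)" using S by simp
        also have "\<dots> < p * (y * F z)"
          using pos p_pos by (intro mult_strict_right_mono) (auto simp: pos_divide_less_eq)
        finally show ?thesis using le Gy by linarith
      qed
    qed
  qed
  have "(p + 1) * F (y / 3) = F y" using cantor_cdf_shrink[of y] y p_pos by simp
  then have "(p + 1) * (1 - F (y / 3)) = p + 1 - F y" by (simp add: right_diff_distrib)
  moreover have "3 * (p + 1) * (y / 3 * (1 - F (y / 3))) = y * ((p + 1) * (1 - F (y / 3)))"
    by (simp add: field_simps)
  ultimately have "3 * (p + 1) * (y / 3 * (1 - F (y / 3))) = y * (p + 1 - F y)" by simp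
  also have "\<dots> < 3 * (p + 1) * G (y / 3)"
    unfolding tail_integral_shrink[OF y] using key by (simp add: algebra_simps)
  finally show ?thesis using p_pos by (simp add: mult_less_cancel_left_pos)
qed

text \<open>Tripling \<open>x\<close> eventually leads into \<open>[1/3,1)\<close>, where the
  shrinking step can start.\<close>

lemma tail_integral_above_diagonal:
  assumes "(1/3) ^ n \<le> x" "x < 1/3"
  shows "x * (1 - F x) < G x"
  using assms
proof (induction n arbitrary: x)
  case 0
  then show ?case by simp
next
  case (Suc n)
  have x: "0 < x" using less_le_trans[OF _ Suc.prems(1)] by simp
  have "1/3 \<le> 3 * x \<or> 3 * x * (1 - F (3 * x)) < G (3 * x)"
    using Suc.IH[of "3 * x"] Suc.prems by force
  then show ?case
    using tail_integral_above_diagonal_shrink[of "3 * x"] x Suc.prems(2) by simp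
qed

text \<open>On the middle third the equation is linear with solution
  \<open>(\<Phi> 1 + 2) / 6\<close>. To its left \<open>mrl p\<close> lies above the diagonal, to
  its right below.\<close>

lemma mrl_fixed_points:
  "{x \<in> {0..1}. mrl p x = x} = {1/6 + (5*p + 4) / (12 * (2*p + 1))}"
proof -
  have sol: "(\<Phi> 1 + 2) / 6 = 1/6 + (5*p + 4) / (12 * (2*p + 1))"
    unfolding cdf_primitive_1 using p_pos by (simp add: divide_simps) (simp add: algebra_simps)
  have "\<Phi> 1 < 2" using p_pos by (simp add: cdf_primitive_1 pos_divide_less_eq)
  then have range: "1/3 \<le> (\<Phi> 1 + 2) / 6" "(\<Phi> 1 + 2) / 6 \<le> 2/3" using cdf_primitive_1_pos by simp_all
  have eq: "mrl p x = x \<longleftrightarrow> G x = x * (1 - F x)" if "0 \<le> x" "x < 1" for x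
    using that cantor_cdf_less_1[of x] by (simp add: mrl_eq divide_eq_eq)
  have "mrl p x = x \<longleftrightarrow> x = (\<Phi> 1 + 2) / 6" if x: "x \<in> {0..1}" for x
  proof -
    consider "x = 0" | "0 < x" "x < 1/3" | "1/3 \<le> x" "x \<le> 2/3" | "2/3 < x" using x by force
    then show ?thesis
    proof cases
      case 1
      then show ?thesis using eq[of 0] tail_integral_pos[of 0] range by simp
    next
      case 2
      obtain n where "(1/3) ^ n < x" using 2 real_arch_pow_inv[of x "1/3"] by auto
      then have "x * (1 - F x) < G x" using 2 tail_integral_above_diagonal[of n x] by simp
      then show ?thesis using eq[of x] 2 range by auto
    next
      case 3
      \<comment> \<open>The argument is at least 1, where \<open>F = 1\<close> and
        \<open>\<Phi>\<close> has slope 1.\<close>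
      have "\<Phi> (3 - 3 * x) = \<Phi> 1 + 2 - 3 * x"
        using cdf_primitive_diff_bounds[of 1 "3 - 3 * x"] 3
          cantor_cdf_upper[of 1] cantor_cdf_upper[of "3 - 3 * x"] by simp
      then have "G x = p / (3 * (p + 1)) * (\<Phi> 1 + 2 - 3 * x)"
        using cdf_primitive_right[of x] 3 by (simp add: tail_integral_def)
      moreover have "x * (1 - F x) = p / (3 * (p + 1)) * (3 * x)"
        unfolding cantor_cdf_mid[OF 3] using p_pos by (simp add: divide_simps)
      ultimately have "G x = x * (1 - F x) \<longleftrightarrow> \<Phi> 1 + 2 - 3 * x = 3 * x" using p_pos by simp
      then show ?thesis using eq[of x] 3 by auto
    next
      case 4
      then show ?thesis using mrl_bounds(2)[of x] x range by auto
    qed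
  qed
  moreover have "(\<Phi> 1 + 2) / 6 \<in> {0..1}" using range by simp
  ultimately show ?thesis unfolding sol[symmetric] by blast
qed

subsection \<open>The mean\<close>

text \<open>The mean is the integral of the tail probability \<open>1 - F\<close> over
  \<open>[0,1]\<close>, by Fubini.\<close>

lemma cantor_law_expectation: "(\<integral>x. x \<partial>(cantor_law p)) = 3/2 * (p / (2*p + 1))"
proof -
  let ?M = "interval_measure F"
  note mono = cantor_cdf_mono
  have cont: "continuous (at_right a) F" for a
    using cantor_cdf_continuous[of UNIV]
    by (simp add: continuous_on_eq_continuous_at continuous_at_imp_continuous_at_within)
  interpret M: real_distribution ?M
  proof (rule real_distribution_interval_measure[OF mono cont])
    show "(F \<longlongrightarrow> 0) at_bot"
      by (rule tendsto_eventually)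
        (auto simp: eventually_at_bot_linorder cantor_cdf_lower intro!: exI[of _ 0])
    show "(F \<longlongrightarrow> 1) at_top"
      by (rule tendsto_eventually)
        (auto simp: eventually_at_top_linorder cantor_cdf_upper intro!: exI[of _ 1])
  qed
  interpret pair_sigma_finite lborel ?M ..
  have "M.prob {0<..1} = 1"
    by (simp add: measure_interval_measure_Ioc[OF _ mono cont] cantor_cdf_lower cantor_cdf_upper)
  then have AE: "AE x in ?M. x \<in> {0<..1}" by (subst M.AE_in_set_eq_1) auto
  \<comment> \<open>Integrating over \<open>u\<close> gives \<open>x\<close>; integrating over
    \<open>x\<close> gives the mass of \<open>{u<..1}\<close>, which is
    \<open>1 - F u\<close>.\<close>
  define f :: "real \<Rightarrow> real \<Rightarrow> ennreal"
    where "f u x = indicator {0..1} u * indicator {u<..1} x" for u x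
  have f_alt: "f u x = (if 0 \<le> u \<and> u \<le> 1 \<and> u < x \<and> x \<le> 1 then 1 else 0)" for u x
    by (auto simp: f_def indicator_def)
  have f_meas: "case_prod f \<in> borel_measurable (lborel \<Otimes>\<^sub>M ?M)"
    unfolding f_alt[abs_def] by measurable
  have inner: "(\<integral>\<^sup>+ u. f u x \<partial>lborel) = ennreal x" if "x \<in> {0<..1}" for x
  proof -
    have "f u x = indicator {0..<x} u" for u using that by (auto simp: f_alt indicator_def)
    then show ?thesis using that by simp
  qed
  have "(\<integral>\<^sup>+ x. ennreal x \<partial>?M) = (\<integral>\<^sup>+ x. (\<integral>\<^sup>+ u. f u x \<partial>lborel) \<partial>?M)"
    by (intro nn_integral_cong_AE) (use AE inner in auto)
  also have "\<dots> = (\<integral>\<^sup>+ u. (\<integral>\<^sup>+ x. f u x \<partial>?M) \<partial>lborel)"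
    by (rule Fubini'[OF f_meas])
  also have "\<dots> = (\<integral>\<^sup>+ u. ennreal (1 - F u) * indicator {0..1} u \<partial>lborel)"
  proof (intro nn_integral_cong)
    fix u :: real
    have "(\<integral>\<^sup>+ x. f u x \<partial>?M) = indicator {0..1} u * emeasure ?M {u<..1}"
      unfolding f_def by (simp add: nn_integral_cmult)
    then show "(\<integral>\<^sup>+ x. f u x \<partial>?M) = ennreal (1 - F u) * indicator {0..1} u"
      by (auto simp: emeasure_interval_measure_Ioc[OF _ mono cont] cantor_cdf_upper indicator_def)
  qed
  also have "\<dots> = ennreal ((1 - \<Phi> 1) - (0 - \<Phi> 0))"
  proof (rule nn_integral_FTC_Icc)
    show "(\<lambda>u. 1 - F u) \<in> borel_measurable borel"
      by (intro borel_measurable_continuous_onI continuous_intros cantor_cdf_continuous)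
  qed (auto intro!: derivative_eq_intros cdf_primitive_deriv simp: cantor_cdf_le_1)
  finally have "(\<integral>\<^sup>+ x. ennreal x \<partial>?M) = ennreal (1 - \<Phi> 1)" by (simp add: cdf_primitive_0)
  moreover have "1 - \<Phi> 1 = 3/2 * (p / (2*p + 1))"
    unfolding cdf_primitive_1 using p_pos by (simp add: divide_simps)
  moreover have "AE x in ?M. 0 \<le> x" using AE by eventually_elim simp
  ultimately show ?thesis
    unfolding cantor_law_def using p_pos by (subst integral_eq_nn_integral) auto
qed

end

theorem theorem2:
  fixes p :: real
  assumes "p > 0"
  shows
    "(\<integral>x. x \<partial>(cantor_law p)) = 3/2 * (p / (2*p + 1))
     \<and> continuous_on {0..1} (mrl p)
     \<and> continuous_on {0<..<1} (gmrl p)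
     \<and> (\<forall>x\<in>{0<..<1}.
          (locally_decreasing_at (mrl p) x \<longleftrightarrow> x \<in> {0..1} - cantor_set)
        \<and> (locally_decreasing_at (gmrl p) x \<longleftrightarrow> x \<in> {0..1} - cantor_set))
     \<and> {x \<in> {0..1}. mrl p x = x} = {1/6 + (5*p + 4) / (12 * (2*p + 1))}
     \<and> (\<forall>q r::real. 0 < q \<longrightarrow> q < r \<longrightarrow>
          1/6 + (5*r + 4) / (12 * (2*r + 1)) < 1/6 + (5*q + 4) / (12 * (2*q + 1)))
     \<and> (\<forall>q::real. 0 < q \<longrightarrow>
          1/6 + (5*q + 4) / (12 * (2*q + 1)) \<in> {3/8<..<1/2})"
proof (intro conjI ballI allI impI)
  show "(\<integral>x. x \<partial>(cantor_law p)) = 3/2 * (p / (2*p + 1))"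
    using assms by (rule cantor_law_expectation)
  show "continuous_on {0..1} (mrl p)" "continuous_on {0<..<1} (gmrl p)"
    using assms by (rule mrl_continuous, rule gmrl_continuous)
  show "{x \<in> {0..1}. mrl p x = x} = {1/6 + (5*p + 4) / (12 * (2*p + 1))}"
    using assms by (rule mrl_fixed_points)
next
  fix x :: real assume "x \<in> {0<..<1}"
  then show "locally_decreasing_at (mrl p) x \<longleftrightarrow> x \<in> {0..1} - cantor_set"
    "locally_decreasing_at (gmrl p) x \<longleftrightarrow> x \<in> {0..1} - cantor_set"
    using assms by (rule locally_decreasing_iff[rotated])+
next
  fix q r :: real assume "0 < q" "q < r"
  \<comment> \<open>The closed form equals \<open>3/8 + 1 / (8 * (2*q + 1))\<close>, which decreases
    in \<open>q\<close> and stays strictly between \<open>3/8\<close> and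
    \<open>1/2\<close>.\<close>
  then show "1/6 + (5*r + 4) / (12 * (2*r + 1)) < 1/6 + (5*q + 4) / (12 * (2*q + 1))"
    by (simp add: divide_simps) (simp add: algebra_simps)
next
  fix q :: real assume "0 < q"
  then show "1/6 + (5*q + 4) / (12 * (2*q + 1)) \<in> {3/8<..<1/2}"
    by (simp add: divide_simps)
qed

end
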